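(* Let $d\ge2$ be an integer. Suppose that $a \in \mathbb{R}^d$ satisfies $\bar a_k > 0$ for $k=2,\dots,d$ and that $\bar a_1 = -M$ for some $M \in \mathbb{N}$. Then for any $n \in \mathbb{N}_0^d$ with $\bar n_1 \leq M$, $$\mathbb{E}_a\left[\prod_{k=1}^d Y_k^{n_k}\right] = \frac{ \displaystyle \sum_{m \in \mathbb{N}_0^d(M-\bar n_1)} \binom{M - \bar n_1}{m_1,\dots, m_d} \prod_{k=2}^d \frac{\bar a_k}{\bar a_k + \bar m_k + \bar n_k}} {\displaystyle \sum_{m \in \mathbb{N}_0^d(M)} \binom{M}{m_1,\dots, m_d}\prod_{k=2}^d \frac{ \bar a_k}{\bar a_k + \bar m_k}}.$$
   Context: For a vector $v \in \mathbb{R}^d$, write $\bar v_k := v_k + v_{k+1} + \dots + v_d$ for its tail sums, $k=1,\dots,d$. $\mathbb{N} = \{1,2,\dots\}$, $\mathbb{N}_0 = \mathbb{N}\cup\{0\}$, and for an integer $L \ge 0$, $\mathbb{N}_0^d(L) = \{m \in \mathbb{N}_0^d : \bar m_1 = L\}$ (so $\mathbb{N}_0^d(0)=\{0\}$). For $m\in\mathbb{N}_0^d(L)$, $\binom{L}{m_1,\dots,m_d} = \frac{L!}{m_1!\cdots m_d!}$. The ordered simplex is $\nabla^{d-1} = \{y \in \mathbb{R}^d: y_1 \geq y_2\geq \dots \geq y_d \geq 0,\ y_1+\dots+y_d = 1\}$. Integrals $dy$ over $\nabla^{d-1}$ are with respect to the pushforward of Lebesgue measure on $\mathbb{R}^{d-1}$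 under $(y_1,\dots,y_{d-1}) \mapsto (y_1,\dots,y_{d-1},1-y_1-\dots-y_{d-1})$. For $a \in \mathbb{R}^d$ with $\bar a_k>0$ for $k=2,\dots,d$, the constant $Q_a = \int_{\nabla^{d-1}}\prod_{k=1}^d y_k^{a_k-1}\,dy$ is finite (known fact), and the Generalized Rank Dirichlet distribution GRD$(a)$ is the probability measure $\mathbb{P}_a(A) = Q_a^{-1}\int_{\nabla^{d-1}} \prod_{k=1}^d y_k^{a_k-1} 1_A(y)\,dy$ on Borel subsets $A$ of $\nabla^{d-1}$. $\mathbb{E}_a$ denotes expectation under $\mathbb{P}_a$, and $Y=(Y_1,\dots,Y_d)$ is a random vector with law $\mathbb{P}_a$ under $\mathbb{P}_a$ (e.g. the identity map on $\nabla^{d-1}$). *)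

theory Defs
  imports "HOL-Probability.Probability"
begin

text \<open>
  Vectors of length \<open>d\<close> are functions on \<^typ>\<open>nat\<close> indexed by \<open>{1..d}\<close>. Only the values on
  \<open>{1..d}\<close> matter; where sets or spaces of vectors are formed, they consist of
  functions that are extensional on \<open>{1..d}\<close>, so that each vector is represented once.
\<close>

definition tail :: "nat \<Rightarrow> (nat \<Rightarrow> 'a::comm_monoid_add) \<Rightarrow> nat \<Rightarrow> 'a" where
  "tail d v k = (\<Sum>i=k..d. v i)"

definition weak_comps :: "nat \<Rightarrow> nat \<Rightarrow> (nat \<Rightarrow> nat) set" where
  "weak_comps d L = {m \<in> {1..d} \<rightarrow>\<^sub>E UNIV. tail d m 1 = L}"

definition multinom :: "nat \<Rightarrow> nat \<Rightarrow> (nat \<Rightarrow> nat) \<Rightarrow> real" where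
  "multinom d L m = fact L / (\<Prod>k=1..d. fact (m k))"

definition ord_simplex :: "nat \<Rightarrow> (nat \<Rightarrow> real) set" where
  "ord_simplex d = {y \<in> {1..d} \<rightarrow>\<^sub>E UNIV.
     (\<forall>k\<in>{1..<d}. y (Suc k) \<le> y k) \<and> 0 \<le> y d \<and> (\<Sum>k=1..d. y k) = 1}"

definition complete_coord :: "nat \<Rightarrow> (nat \<Rightarrow> real) \<Rightarrow> (nat \<Rightarrow> real)" where
  "complete_coord d y = y(d := 1 - (\<Sum>k\<in>{1..<d}. y k))"

text \<open>
  The reference measure \<open>dy\<close>: Lebesgue measure on the first \<open>d - 1\<close> coordinates, pushed
  forward to the hyperplane where the coordinates sum to 1, and restricted to the ordered simplex.
\<close>

definition simplex_measure :: "nat \<Rightarrow> (nat \<Rightarrow> real) measure" where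
  "simplex_measure d =
     restrict_space
       (distr (\<Pi>\<^sub>M k\<in>{1..<d}. lborel) (\<Pi>\<^sub>M k\<in>{1..d}. borel) (complete_coord d))
       (ord_simplex d)"

text \<open>
  Since \<^term>\<open>0 powr x = (0::real)\<close>, the weight vanishes where some coordinate is 0, whatever the
  exponent; this affects only a null set.
\<close>

definition GRD_weight :: "nat \<Rightarrow> (nat \<Rightarrow> real) \<Rightarrow> (nat \<Rightarrow> real) \<Rightarrow> real" where
  "GRD_weight d a y = (\<Prod>k=1..d. y k powr (a k - 1))"

definition GRD_const :: "nat \<Rightarrow> (nat \<Rightarrow> real) \<Rightarrow> ennreal" where
  "GRD_const d a = (\<integral>\<^sup>+ y. ennreal (GRD_weight d a y) \<partial>simplex_measure d)"

definition GRD :: "nat \<Rightarrow> (nat \<Rightarrow> real) \<Rightarrow> (nat \<Rightarrow> real) measure" where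
  "GRD d a =
     density (simplex_measure d) (\<lambda>y. ennreal (GRD_weight d a y) / GRD_const d a)"

end

theory Submission
  imports Defs
begin

text \<open>
  Write $Q_c$ for the normalising constant of GRD$(c)$, so that the expectation is
  $Q_{a+n} / Q_a$. On the simplex $(y_1 + \dots + y_d)^L = 1$, and the multinomial theorem turns
  a constant $Q_c$ with $\bar c_1 = -L$ into a combination of constants $Q_b$ with $\bar b_1 = 0$.
  For such $b$ one has $Q_b = \prod_{k=2}^d 1 / \bar b_k$: the weight on the ordered cone is then
  homogeneous of degree $-d$, so its integral over a section of the cone does not depend on the
  section. To compare the sections $y_1 + \dots + y_d = 1$ and $y_1 = 1$ using only shifts and
  scalings of single coordinates, integrate the weight times a radial function of
  $y_1 + \dots + y_d$ over the whole cone, splitting off $y_d$ in one case and $y_1$ in the other.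
  Over the section $y_1 = 1$ the integral is iterated from $y_d$ upwards.
\<close>

section \<open>The multinomial theorem over a finite index set\<close>

text \<open>Induction on the index set: fixing the exponent k of the new index leaves a sum of
  degree L - k over the old indices, and summing over k is the binomial theorem. Exponents range
  over extensional functions so that each one is counted once, as in
  \<open>weak_comps\<close>.\<close>

lemma sum_power_multinomial:
  fixes x :: "'a \<Rightarrow> real"
  assumes "finite I"
  shows "(\<Sum>m\<in>{m \<in> I \<rightarrow>\<^sub>E UNIV. sum m I = L}. fact L / (\<Prod>i\<in>I. fact (m i)) * (\<Prod>i\<in>I. x i ^ m i))
    = (\<Sum>i\<in>I. x i) ^ L"
  using assms
proof (induction I arbitrary: L rule: finite_induct)
  case empty
  \<comment> \<open>The empty index set carries a single exponent, the everywhere undefined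
    function, so the sum is 1 for L = 0 and 0 otherwise, which is 0 ^ L.\<close>
  have "{m \<in> {} \<rightarrow>\<^sub>E (UNIV::nat set). sum m {} = L} = (if L = 0 then {\<lambda>_::'a. undefined} else {})"
    by auto
  then show ?case by simp
next
  case (insert i I)
  let ?W = "\<lambda>J L. {m \<in> J \<rightarrow>\<^sub>E (UNIV::nat set). sum m J = L}"
  let ?t = "\<lambda>J L m. fact L / (\<Prod>i\<in>J. fact (m i)) * (\<Prod>i\<in>J. x i ^ m i) :: real"
  have fin: "finite (?W I L)" for L
  proof (rule finite_subset)
    show "?W I L \<subseteq> I \<rightarrow>\<^sub>E {..L}"
      by (auto simp: PiE_def Pi_def insert.hyps(1) member_le_sum)
  qed (simp add: finite_PiE insert.hyps(1))
  have "(\<Sum>m\<in>?W (insert i I) L. ?t (insert i I) L m) =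
    (\<Sum>(k, m)\<in>(SIGMA k:{..L}. ?W I (L - k)). (real (L choose k) * x i ^ k) * ?t I (L - k) m)"
  \<comment> \<open>An exponent on the larger set corresponds to its value at i together with its
    restriction; resetting i to \<open>undefined\<close> keeps the restriction extensional.\<close>
  proof (rule sum.reindex_bij_witness[of _ "\<lambda>(k, m). m(i := k)" "\<lambda>m. (m i, m(i := undefined))"], goal_cases)
    case (2 m)
    have "sum (m(i := undefined)) I = sum m I"
      by (rule sum.cong) (use insert.hyps in auto)
    with 2 insert.hyps show ?case
      by (auto simp: PiE_def extensional_def)
  next
    case (3 p)
    then show ?case
      using insert.hyps by (auto simp: PiE_def extensional_def)
  next
    case (4 p)
    obtain k m where p: "p = (k, m)" by force
    have "sum (m(i := k)) I = sum m I"
      by (rule sum.cong) (use insert.hyps in auto)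
    with 4 insert.hyps show ?case
      by (auto simp: PiE_def extensional_def p)
  next
    case (5 m)
    have *: "L = m i + sum m I" using 5 insert.hyps by auto
    have r: "(\<Prod>j\<in>I. fact ((m(i := undefined)) j)) = (\<Prod>j\<in>I. fact (m j) :: real)"
      "(\<Prod>j\<in>I. x j ^ ((m(i := undefined)) j)) = (\<Prod>j\<in>I. x j ^ m j)"
      by (rule prod.cong; use insert.hyps in auto)+
    \<comment> \<open>The factor fact (L - m i) cancels the numerator of the smaller multinomial
      coefficient.\<close>
    have b: "real (L choose m i) = fact L / (fact (m i) * fact (L - m i))"
      using * by (intro binomial_fact) simp
    show ?case
      unfolding prod.case r b using insert.hyps by simp
  qed auto
  also have "\<dots> = (\<Sum>k\<le>L. real (L choose k) * x i ^ k * (\<Sum>j\<in>I. x j) ^ (L - k))"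
    by (subst sum.Sigma[symmetric]) (simp_all only: fin finite_atMost prod.case insert.IH simp_thms Ball_def flip: sum_distrib_left)
  also have "\<dots> = (\<Sum>j\<in>insert i I. x j) ^ L"
    using insert.hyps by (simp add: binomial_ring)
  finally show ?case .
qed

section \<open>Scaling of Lebesgue measure and integrals of powers\<close>

lemma product_sigma_finite_lborel: "product_sigma_finite (\<lambda>_. lborel :: real measure)"
  by (intro product_sigma_finite.intro lborel.sigma_finite_measure_axioms)

text \<open>Each coordinate contributes one factor r by the one-dimensional substitution. The scaled
  vector is restricted to I so that it stays in the product space.\<close>

lemma nn_integral_PiM_lborel_scale:
  fixes f :: "('i \<Rightarrow> real) \<Rightarrow> ennreal"
  assumes "finite I" and r: "0 < r" and "f \<in> borel_measurable (\<Pi>\<^sub>M i\<in>I. lborel)"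
  shows "(\<integral>\<^sup>+x. f x \<partial>(\<Pi>\<^sub>M i\<in>I. lborel)) =
    ennreal (r ^ card I) * (\<integral>\<^sup>+x. f (\<lambda>i\<in>I. r * x i) \<partial>(\<Pi>\<^sub>M i\<in>I. lborel))"
proof -
  interpret product_sigma_finite "\<lambda>_::'i. lborel :: real measure"
    by (rule product_sigma_finite_lborel)
  show ?thesis
    using assms(1,3)
  proof (induction I arbitrary: f rule: finite_induct)
    case empty
    then show ?case
      by (subst (1 2) nn_integral_empty) (simp_all add: restrict_def)
  next
    case (insert i I)
    note [measurable] = insert.prems
    let ?P = "\<lambda>I. \<Pi>\<^sub>M i\<in>I. (lborel :: real measure)"
    have m: "(\<lambda>x. \<integral>\<^sup>+t. f (x(i := r * t)) \<partial>lborel) \<in> borel_measurable (?P I)"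
      by measurable
    have sc: "(\<lambda>x. \<lambda>j\<in>insert i I. r * x j) \<in> measurable (?P (insert i I)) (?P (insert i I))"
      by measurable
    have mf: "(\<lambda>x. f (\<lambda>j\<in>insert i I. r * x j)) \<in> borel_measurable (?P (insert i I))"
      using sc insert.prems by (rule measurable_compose)
    have "(\<integral>\<^sup>+x. f x \<partial>?P (insert i I)) = (\<integral>\<^sup>+x. (\<integral>\<^sup>+t. f (x(i := t)) \<partial>lborel) \<partial>?P I)"
      by (rule product_nn_integral_insert) (use insert in auto)
    also have "\<dots> = (\<integral>\<^sup>+x. ennreal r * (\<integral>\<^sup>+t. f (x(i := r * t)) \<partial>lborel) \<partial>?P I)"
    proof (rule nn_integral_cong)
      fix x assume "x \<in> space (?P I)"
      then have "(\<lambda>t. f (x(i := t))) \<in> borel_measurable borel"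
        by measurable
      from nn_integral_real_affine[OF this, of r 0] r
      show "(\<integral>\<^sup>+t. f (x(i := t)) \<partial>lborel) = ennreal r * (\<integral>\<^sup>+t. f (x(i := r * t)) \<partial>lborel)"
        by simp
    qed
    \<comment> \<open>The induction hypothesis is applied to the function left after integrating out
      the new coordinate, already rescaled.\<close>
    also have "\<dots> = ennreal r * (ennreal (r ^ card I) *
        (\<integral>\<^sup>+x. (\<integral>\<^sup>+t. f ((\<lambda>j\<in>I. r * x j)(i := r * t)) \<partial>lborel) \<partial>?P I))"
      by (simp only: nn_integral_cmult[OF m] insert.IH[OF m])
    also have "(\<integral>\<^sup>+x. (\<integral>\<^sup>+t. f ((\<lambda>j\<in>I. r * x j)(i := r * t)) \<partial>lborel) \<partial>?P I) =
        (\<integral>\<^sup>+x. f (\<lambda>j\<in>insert i I. r * x j) \<partial>?P (insert i I))"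
      by (subst product_nn_integral_insert[OF insert.hyps(1,2) mf],
          intro nn_integral_cong arg_cong[of _ _ f])
        (auto simp: fun_eq_iff restrict_def insert.hyps)
    finally have "(\<integral>\<^sup>+x. f x \<partial>?P (insert i I)) = ennreal r * (ennreal (r ^ card I) *
        (\<integral>\<^sup>+x. f (\<lambda>j\<in>insert i I. r * x j) \<partial>?P (insert i I)))" .
    moreover have "ennreal (r ^ card (insert i I)) = ennreal r * ennreal (r ^ card I)"
      using insert.hyps r by (simp add: ennreal_mult)
    ultimately show ?case
      by (simp only: mult.assoc)
  qed
qed

text \<open>Here 0 < c gives integrability at 0. In the iterated integral c is a tail sum, and this
  is where positivity of the tails enters.\<close>

lemma nn_integral_powr_Icc:
  assumes "0 < c" "0 \<le> s"
  shows "(\<integral>\<^sup>+t. ennreal (t powr (c - 1)) * indicator {0..s} t \<partial>lborel) = ennreal (s powr c / c)"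
proof -
  have "((\<lambda>t. indicator {0..s} t * t powr (c - 1)) has_integral s powr c / c) UNIV"
    using has_integral_powr_from_0[of "c - 1" s] assms
      has_integral_restrict_UNIV[of "{0..s}" "\<lambda>t. t powr (c - 1)" "s powr c / c"]
    by (simp add: indicator_def of_bool_def if_distrib if_distribR cong: if_cong)
  from nn_integral_has_integral_lborel[OF _ _ this]
  have "(\<integral>\<^sup>+t. ennreal (indicator {0..s} t * t powr (c - 1)) \<partial>lborel) = ennreal (s powr c / c)"
    by simp
  moreover have "ennreal (t powr (c - 1)) * indicator {0..s} t =
      ennreal (indicator {0..s} t * t powr (c - 1))" for t
    by (simp add: indicator_def)
  ultimately show ?thesis
    by simp
qed

section \<open>The ordered cone and its weight\<close>

text \<open>The starting index j is a parameter so that the largest coordinates can be peeled off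
  one at a time. Extensionality is left out, so that the predicate applies to updated and rescaled
  vectors alike.\<close>

definition chain :: "nat \<Rightarrow> nat \<Rightarrow> (nat \<Rightarrow> real) \<Rightarrow> bool" where
  "chain j d y \<longleftrightarrow> (\<forall>k\<in>{j..<d}. y (Suc k) \<le> y k) \<and> 0 \<le> y d"

text \<open>The unnormalised density, extended by 0 outside the ordered cone. Values in
  \<open>ennreal\<close> allow integrals to be exchanged before finiteness is known.\<close>

definition cone_weight :: "nat \<Rightarrow> (nat \<Rightarrow> real) \<Rightarrow> (nat \<Rightarrow> real) \<Rightarrow> ennreal" where
  "cone_weight d b y = ennreal (GRD_weight d b y) * indicator (Collect (chain 1 d)) y"

lemma chain_Suc: "j < d \<Longrightarrow> chain j d y \<longleftrightarrow> y (Suc j) \<le> y j \<and> chain (Suc j) d y"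
  unfolding chain_def by (auto simp: Suc_le_eq order.order_iff_strict)

lemma chain_cong: "(\<And>k. k \<in> {j..d} \<Longrightarrow> y k = z k) \<Longrightarrow> j \<le> d \<Longrightarrow> chain j d y = chain j d z"
  unfolding chain_def by (intro arg_cong2[of _ _ _ _ "(\<and>)"] ball_cong) auto

lemma chain_nonneg: "chain j d y \<Longrightarrow> k \<in> {j..d} \<Longrightarrow> 0 \<le> y k"
proof -
  assume c: "chain j d y" and k: "k \<in> {j..d}"
  from k have "k \<le> d" by simp
  then have "j \<le> k \<longrightarrow> 0 \<le> y k"
  proof (induction rule: inc_induct)
    case (step n)
    then show ?case
      using c by (auto simp: chain_def intro: order_trans)
  qed (use c in \<open>simp add: chain_def\<close>)
  with k show ?thesis by simp
qed

lemma measurable_chain [measurable]: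
  assumes "j \<le> d" "{j..d} \<subseteq> I"
  shows "Measurable.pred (\<Pi>\<^sub>M k\<in>I. borel) (chain j d)"
proof -
  have [measurable]: "(\<lambda>y. y k) \<in> borel_measurable (\<Pi>\<^sub>M k\<in>I. borel)" if "k \<in> {j..d}" for k
    using that assms by (intro measurable_component_singleton) auto
  show ?thesis
    unfolding chain_def
    using assms
    by (intro pred_intros_logic pred_intros_finite borel_measurable_le[unfolded pred_def[symmetric]]) auto
qed

text \<open>Both products have the same sigma-algebra; measurability is proved for
  \<open>borel\<close> and used in integrals against \<open>lborel\<close>.\<close>

lemma measurable_PiM_lborel_eq [simp]:
  "measurable (\<Pi>\<^sub>M k\<in>I. lborel) N = measurable (\<Pi>\<^sub>M k\<in>I. borel) N"
  by (intro measurable_cong_sets sets_PiM_cong) auto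

lemma measurable_prod_powr:
  assumes "J \<subseteq> I"
  shows "(\<lambda>y. \<Prod>k\<in>J. y k powr (e k :: real)) \<in> borel_measurable (\<Pi>\<^sub>M k\<in>I. borel)"
proof -
  have [measurable]: "(\<lambda>y. y k) \<in> borel_measurable (\<Pi>\<^sub>M k\<in>I. borel)" if "k \<in> J" for k
    using that assms by (intro measurable_component_singleton) auto
  show ?thesis
    by measurable
qed

section \<open>Iterated integration over a section of the cone\<close>

lemma tail_Suc: "k \<le> d \<Longrightarrow> tail d v k = v k + tail d v (Suc k)"
  by (simp add: tail_def sum.atLeast_Suc_atMost)

text \<open>Descending induction on j, with s the value of coordinate j. If coordinate j + 1 has
  value t, the later coordinates integrate to a constant times t to the power of tail j + 2.
  Multiplying by t powr (b (j + 1) - 1) raises the exponent to tail j + 1 minus 1, and integrating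
  over t from 0 to s yields the next factor.\<close>

lemma nn_integral_chain:
  assumes "j \<le> d" "\<And>k. k \<in> {Suc j..d} \<Longrightarrow> 0 < tail d b k" "0 < s"
  shows "(\<integral>\<^sup>+z. ennreal (\<Prod>k=Suc j..d. z k powr (b k - 1)) *
      indicator (Collect (chain j d)) (z(j := s)) \<partial>(\<Pi>\<^sub>M k\<in>{Suc j..d}. lborel)) =
    ennreal (s powr tail d b (Suc j) * (\<Prod>k=Suc j..d. 1 / tail d b k))"
  using assms
proof (induction j arbitrary: s rule: inc_induct)
  \<comment> \<open>No coordinate is left: the chain condition is 0 <= s and the tail beyond d is
    the empty sum, so both sides are 1.\<close>
  case base
  interpret product_sigma_finite "\<lambda>_::nat. lborel :: real measure"
    by (rule product_sigma_finite_lborel)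
  show ?case
    using base by (simp add: nn_integral_empty tail_def chain_def del: nn_integral_const)
next
  case (step j)
  interpret product_sigma_finite "\<lambda>_::nat. lborel :: real measure"
    by (rule product_sigma_finite_lborel)
  let ?P = "\<lambda>I. \<Pi>\<^sub>M k\<in>I. (lborel :: real measure)"
  let ?f = "\<lambda>j s z. ennreal (\<Prod>k=Suc j..d. z k powr (b k - 1)) *
      indicator (Collect (chain j d)) (z(j := s))"
  let ?C = "\<Prod>k=Suc (Suc j)..d. 1 / tail d b k"
  have ins: "{Suc j..d} = insert (Suc j) {Suc (Suc j)..d}"
    using step by auto
  have rev: "(\<integral>\<^sup>+z. f z \<partial>?P {Suc j..d}) = (\<integral>\<^sup>+t. (\<integral>\<^sup>+z. f (z(Suc j := t)) \<partial>?P {Suc (Suc j)..d}) \<partial>lborel)"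
    if "f \<in> borel_measurable (?P {Suc j..d})" for f
    using that unfolding ins by (intro product_nn_integral_insert_rev) simp_all
  have C: "0 \<le> ?C"
    using step.prems(1) by (intro prod_nonneg) (auto simp: less_imp_le)
  have mf: "?f i t \<in> borel_measurable (?P {Suc i..d})" if "i \<le> d" for i t
  proof -
    have "(\<lambda>z. z(i := t)) \<in> measurable (\<Pi>\<^sub>M k\<in>{Suc i..d}. borel) (\<Pi>\<^sub>M k\<in>{i..d}. borel)"
      by (rule measurable_fun_upd[where J = "{Suc i..d}"]) (use that in auto)
    then have "Measurable.pred (\<Pi>\<^sub>M k\<in>{Suc i..d}. borel) (\<lambda>z. chain i d (z(i := t)))"
      by (rule measurable_compose) (use that in auto)
    then show ?thesis
      using measurable_prod_powr[of "{Suc i..d}" "{Suc i..d}" "\<lambda>k. b k - 1"]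
      unfolding measurable_PiM_lborel_eq indicator_def mem_Collect_eq
      by measurable
  qed
  \<comment> \<open>The value t = 0 may be left out since 0 powr _ = 0. This keeps t positive, as
    the induction hypothesis requires; negative t violate the chain.\<close>
  have *: "?f j s (z(Suc j := t)) =
      ennreal (t powr (b (Suc j) - 1)) * indicator {0<..s} t * ?f (Suc j) t z" for t z
  proof -
    have p: "(\<Prod>k=Suc j..d. (z(Suc j := t)) k powr (b k - 1)) =
        t powr (b (Suc j) - 1) * (\<Prod>k=Suc (Suc j)..d. z k powr (b k - 1))"
      unfolding ins by simp
    have "chain (Suc j) d (z(Suc j := t, j := s)) = chain (Suc j) d (z(Suc j := t))"
      by (rule chain_cong) (use step.hyps in auto)
    then have c: "chain j d (z(Suc j := t, j := s)) \<longleftrightarrow> t \<le> s \<and> chain (Suc j) d (z(Suc j := t))"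
      using step.hyps by (simp add: chain_Suc)
    have "chain (Suc j) d (z(Suc j := t)) \<Longrightarrow> 0 \<le> t"
      using chain_nonneg[of "Suc j" d "z(Suc j := t)" "Suc j"] step by simp
    then show ?thesis
      unfolding p by (auto simp: indicator_def c ennreal_mult' order.order_iff_strict)
  qed
  have "(\<integral>\<^sup>+z. ?f j s z \<partial>?P {Suc j..d}) =
      (\<integral>\<^sup>+t. (\<integral>\<^sup>+z. ?f j s (z(Suc j := t)) \<partial>?P {Suc (Suc j)..d}) \<partial>lborel)"
    by (rule rev[OF mf]) (use step.hyps in simp)
  also have "\<dots> = (\<integral>\<^sup>+t. ennreal (t powr (b (Suc j) - 1)) * indicator {0<..s} t *
      ennreal (t powr tail d b (Suc (Suc j)) * ?C) \<partial>lborel)"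
  proof (rule nn_integral_cong)
    fix t
    show "(\<integral>\<^sup>+z. ?f j s (z(Suc j := t)) \<partial>?P {Suc (Suc j)..d}) =
      ennreal (t powr (b (Suc j) - 1)) * indicator {0<..s} t * ennreal (t powr tail d b (Suc (Suc j)) * ?C)"
    proof (cases "0 < t")
      case True
      have "(\<integral>\<^sup>+z. ?f j s (z(Suc j := t)) \<partial>?P {Suc (Suc j)..d}) =
          ennreal (t powr (b (Suc j) - 1)) * indicator {0<..s} t * (\<integral>\<^sup>+z. ?f (Suc j) t z \<partial>?P {Suc (Suc j)..d})"
        unfolding * using step.hyps by (intro nn_integral_cmult mf) simp
      also have "(\<integral>\<^sup>+z. ?f (Suc j) t z \<partial>?P {Suc (Suc j)..d}) = ennreal (t powr tail d b (Suc (Suc j)) * ?C)"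
        using step.prems(1) True by (intro step.IH) simp_all
      finally show ?thesis .
    next
      case False
      then show ?thesis
        unfolding * by simp
    qed
  qed
  \<comment> \<open>The powers of t are merged by \<open>tail_Suc\<close>. The endpoint 0 returns at
    no cost, because the power vanishes there.\<close>
  also have "\<dots> = (\<integral>\<^sup>+t. ennreal ?C * (ennreal (t powr (tail d b (Suc j) - 1)) * indicator {0..s} t) \<partial>lborel)"
  proof (rule nn_integral_cong)
    fix t
    show "ennreal (t powr (b (Suc j) - 1)) * indicator {0<..s} t *
          ennreal (t powr tail d b (Suc (Suc j)) * ?C) =
        ennreal ?C * (ennreal (t powr (tail d b (Suc j) - 1)) * indicator {0..s} t)"
      using step.hyps C
      by (auto simp: indicator_def tail_Suc algebra_simps simp flip: ennreal_mult powr_add)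
  qed
  also have "\<dots> = ennreal ?C * ennreal (s powr tail d b (Suc j) / tail d b (Suc j))"
    using step.prems step.hyps by (subst nn_integral_cmult) (simp_all add: nn_integral_powr_Icc)
  also have "\<dots> = ennreal (s powr tail d b (Suc j) * (\<Prod>k=Suc j..d. 1 / tail d b k))"
    unfolding ins using C by (simp add: mult.commute flip: ennreal_mult')
  finally show ?case .
qed

section \<open>Integration over the ordered simplex\<close>

lemma measurable_complete_coord:
  assumes "1 \<le> d"
  shows "complete_coord d \<in> measurable (\<Pi>\<^sub>M k\<in>{1..<d}. borel) (\<Pi>\<^sub>M k\<in>{1..d}. borel)"
  unfolding complete_coord_def
  by (rule measurable_fun_upd[where J = "{1..<d}"]) (use assms in auto)

lemma sum_complete_coord:
  assumes "1 \<le> d"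
  shows "(\<Sum>k=1..d. complete_coord d u k) = 1"
proof -
  have "{1..d} = insert d {1..<d}" using assms by auto
  then show ?thesis
    by (simp add: complete_coord_def)
qed

lemma ord_simplex_eq: "ord_simplex d = {y \<in> {1..d} \<rightarrow>\<^sub>E UNIV. chain 1 d y \<and> (\<Sum>k=1..d. y k) = 1}"
  unfolding ord_simplex_def chain_def by auto

lemma sets_ord_simplex:
  assumes "1 \<le> d"
  shows "ord_simplex d \<in> sets (\<Pi>\<^sub>M k\<in>{1..d}. borel)"
proof -
  have "ord_simplex d = {y \<in> space (\<Pi>\<^sub>M k\<in>{1..d}. borel). chain 1 d y \<and> (\<Sum>k=1..d. y k) = 1}"
    by (simp add: ord_simplex_eq space_PiM)
  also have "\<dots> \<in> sets (\<Pi>\<^sub>M k\<in>{1..d}. borel)"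
  proof -
    have [measurable]: "Measurable.pred (\<Pi>\<^sub>M k\<in>{1..d}. borel) (chain 1 d)"
      using assms by (rule measurable_chain) simp
    show ?thesis by measurable
  qed
  finally show ?thesis .
qed

text \<open>A completed vector is extensional and sums to 1 by construction, so of the conditions
  defining the simplex only the chain survives in the indicator.\<close>

lemma nn_integral_simplex_measure:
  assumes "1 \<le> d" and f: "f \<in> borel_measurable (\<Pi>\<^sub>M k\<in>{1..d}. borel)"
  shows "(\<integral>\<^sup>+y. f y \<partial>simplex_measure d) =
    (\<integral>\<^sup>+u. f (complete_coord d u) * indicator (Collect (chain 1 d)) (complete_coord d u)
      \<partial>(\<Pi>\<^sub>M k\<in>{1..<d}. lborel))"
proof -
  let ?D = "distr (\<Pi>\<^sub>M k\<in>{1..<d}. lborel) (\<Pi>\<^sub>M k\<in>{1..d}. borel) (complete_coord d)"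
  have "(\<integral>\<^sup>+y. f y \<partial>simplex_measure d) = (\<integral>\<^sup>+y. f y * indicator (ord_simplex d) y \<partial>?D)"
    unfolding simplex_measure_def
    by (rule nn_integral_restrict_space) (use sets_ord_simplex[OF assms(1)] in auto)
  also have "\<dots> = (\<integral>\<^sup>+u. f (complete_coord d u) * indicator (ord_simplex d) (complete_coord d u)
      \<partial>(\<Pi>\<^sub>M k\<in>{1..<d}. lborel))"
    using f sets_ord_simplex[OF assms(1)] measurable_complete_coord[OF assms(1)]
    by (intro nn_integral_distr borel_measurable_times_ennreal borel_measurable_indicator)
      (simp_all only: measurable_PiM_lborel_eq measurable_distr_eq1 sets_distr)
  also have "\<dots> = (\<integral>\<^sup>+u. f (complete_coord d u) * indicator (Collect (chain 1 d)) (complete_coord d u)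
      \<partial>(\<Pi>\<^sub>M k\<in>{1..<d}. lborel))"
  proof (rule nn_integral_cong)
    fix u assume "u \<in> space (\<Pi>\<^sub>M k\<in>{1..<d}. (lborel :: real measure))"
    then have "u \<in> space (\<Pi>\<^sub>M k\<in>{1..<d}. (borel :: real measure))"
      by (simp add: space_PiM)
    from measurable_space[OF measurable_complete_coord[OF assms(1)] this]
    have "complete_coord d u \<in> {1..d} \<rightarrow>\<^sub>E UNIV"
      by (simp add: space_PiM)
    then show "f (complete_coord d u) * indicator (ord_simplex d) (complete_coord d u) =
        f (complete_coord d u) * indicator (Collect (chain 1 d)) (complete_coord d u)"
      using sum_complete_coord[OF assms(1), of u] by (simp add: ord_simplex_eq indicator_def)
  qed
  finally show ?thesis .
qed

section \<open>Measurability and homogeneity of the weight\<close>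

lemma measurable_GRD_weight [measurable]:
  "GRD_weight d a \<in> borel_measurable (\<Pi>\<^sub>M k\<in>{1..d}. borel)"
  unfolding GRD_weight_def by (rule measurable_prod_powr) simp

lemma measurable_cone_weight:
  assumes "1 \<le> d"
  shows "cone_weight d b \<in> borel_measurable (\<Pi>\<^sub>M k\<in>{1..d}. borel)"
proof -
  have [measurable]: "Measurable.pred (\<Pi>\<^sub>M k\<in>{1..d}. borel) (chain 1 d)"
    using assms by (rule measurable_chain) simp
  have "cone_weight d b = (\<lambda>y. ennreal (GRD_weight d b y) * indicator (Collect (chain 1 d)) y)"
    by (simp add: cone_weight_def fun_eq_iff)
  also have "\<dots> \<in> borel_measurable (\<Pi>\<^sub>M k\<in>{1..d}. borel)"
    unfolding indicator_def mem_Collect_eq by measurable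
  finally show ?thesis .
qed

lemma cone_weight_cong:
  "1 \<le> d \<Longrightarrow> (\<And>k. k \<in> {1..d} \<Longrightarrow> y k = z k) \<Longrightarrow> cone_weight d b y = cone_weight d b z"
  unfolding cone_weight_def GRD_weight_def indicator_def mem_Collect_eq
  by (intro arg_cong2[of _ _ _ _ "(*)"] arg_cong[of _ _ ennreal] arg_cong[of _ _ of_bool] prod.cong chain_cong) auto

text \<open>The weight has degree equal to the sum of all b k - 1, which is -d when b has total 0.
  The cone itself is invariant under positive scaling.\<close>

lemma cone_weight_scale:
  assumes "1 \<le> d" "tail d b 1 = 0" "0 < r"
  shows "ennreal (r ^ d) * cone_weight d b (\<lambda>k. r * y k) = cone_weight d b y"
proof (cases "chain 1 d y")
  case True
  have "(\<Prod>k=1..d. (r * y k) powr (b k - 1)) = (\<Prod>k=1..d. r powr (b k - 1) * y k powr (b k - 1))"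
    by (intro prod.cong refl powr_mult)
  also have "\<dots> = r powr (\<Sum>k=1..d. b k - 1) * GRD_weight d b y"
    using assms by (simp add: prod.distrib powr_sum GRD_weight_def)
  also have "(\<Sum>k=1..d. b k - 1) = - real d"
    using assms by (simp add: sum_subtractf tail_def)
  finally have "r ^ d * GRD_weight d b (\<lambda>k. r * y k) = GRD_weight d b y"
    using assms by (simp add: GRD_weight_def powr_minus powr_realpow)
  moreover have "chain 1 d (\<lambda>k. r * y k)"
    using True assms by (simp add: chain_def)
  ultimately show ?thesis
    using True assms by (simp add: cone_weight_def flip: ennreal_mult')
next
  case False
  moreover have "\<not> chain 1 d (\<lambda>k. r * y k)"
    using False assms by (simp add: chain_def zero_le_mult_iff)
  ultimately show ?thesis
    by (simp add: cone_weight_def)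
qed

section \<open>Comparison of two sections of the cone\<close>

text \<open>Supplies the joint measurability needed for Tonelli's theorem when one coordinate is a
  function of the others and of a real parameter.\<close>

lemma measurable_fun_upd_PiM_pair:
  fixes h :: "('i \<Rightarrow> real) \<times> real \<Rightarrow> real"
  assumes "I = insert i J" and "h \<in> borel_measurable ((\<Pi>\<^sub>M k\<in>J. lborel) \<Otimes>\<^sub>M lborel)"
    and "H \<in> borel_measurable (\<Pi>\<^sub>M k\<in>I. borel)"
  shows "(\<lambda>p. H ((fst p)(i := h p))) \<in> borel_measurable ((\<Pi>\<^sub>M k\<in>J. lborel) \<Otimes>\<^sub>M lborel)"
proof -
  have "(\<lambda>p. (fst p)(i := h p)) \<in>
      measurable ((\<Pi>\<^sub>M k\<in>J. lborel) \<Otimes>\<^sub>M (lborel :: real measure)) (\<Pi>\<^sub>M k\<in>I. lborel)"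
    by (rule measurable_fun_upd[where J = J]) (use assms(1,2) in auto)
  moreover have "H \<in> borel_measurable (\<Pi>\<^sub>M k\<in>I. lborel)"
    using assms(3) by simp
  ultimately show ?thesis
    by (rule measurable_compose)
qed

lemma nn_integral_PiM_Fubini:
  fixes f :: "('i \<Rightarrow> real) \<Rightarrow> real \<Rightarrow> ennreal"
  assumes "finite I" "case_prod f \<in> borel_measurable ((\<Pi>\<^sub>M k\<in>I. lborel) \<Otimes>\<^sub>M lborel)"
  shows "(\<integral>\<^sup>+t. (\<integral>\<^sup>+u. f u t \<partial>(\<Pi>\<^sub>M k\<in>I. lborel)) \<partial>lborel) =
    (\<integral>\<^sup>+u. (\<integral>\<^sup>+t. f u t \<partial>lborel) \<partial>(\<Pi>\<^sub>M k\<in>I. lborel))"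
proof -
  interpret product_sigma_finite "\<lambda>_::'i. lborel :: real measure"
    by (rule product_sigma_finite_lborel)
  show ?thesis
    by (rule pair_sigma_finite.Fubini'[OF _ assms(2)])
      (simp add: sigma_finite pair_sigma_finite.intro sigma_finite_measures assms(1))
qed

text \<open>The normalising constant appears as the integral over the section with coordinate sum 1,
  parametrised by the first d - 1 coordinates.\<close>

lemma cone_weight_simplex_integral:
  assumes "1 \<le> d"
  shows "GRD_const d b = (\<integral>\<^sup>+u. cone_weight d b (complete_coord d u) \<partial>(\<Pi>\<^sub>M k\<in>{1..<d}. lborel))"
  unfolding GRD_const_def
proof (subst nn_integral_simplex_measure[OF assms])
  show "(\<lambda>y. ennreal (GRD_weight d b y)) \<in> borel_measurable (\<Pi>\<^sub>M k\<in>{1..d}. borel)"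
    by measurable
qed (simp add: cone_weight_def)

text \<open>The factor \<open>r\<close> makes the radial integral against \<open>dr / r\<close> equal to 1.\<close>

definition radial :: "real \<Rightarrow> ennreal" where
  "radial r = ennreal r * indicator {0<..1} r"

lemma measurable_radial [measurable]: "radial \<in> borel_measurable borel"
  unfolding radial_def[abs_def] by measurable

text \<open>Replace the last coordinate by the total r and scale the others by r. The Jacobian r ^
  (d - 1) and the factor r in \<open>radial\<close> together cancel the degree -d of the weight,
  leaving the constant integrated over r in (0, 1].\<close>

lemma cone_integral_last:
  assumes d: "1 \<le> d" and b: "tail d b 1 = 0"
  shows "(\<integral>\<^sup>+y. cone_weight d b y * radial (\<Sum>k=1..d. y k) \<partial>(\<Pi>\<^sub>M k\<in>{1..d}. lborel)) = GRD_const d b"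
proof -
  interpret product_sigma_finite "\<lambda>_::nat. lborel :: real measure"
    by (rule product_sigma_finite_lborel)
  let ?P = "\<lambda>I. \<Pi>\<^sub>M k\<in>I. (lborel :: real measure)"
  let ?H = "cone_weight d b"
  let ?S = "\<lambda>u :: nat \<Rightarrow> real. \<Sum>k\<in>{1..<d}. u k"
  let ?F = "\<lambda>y. ?H y * radial (\<Sum>k=1..d. y k)"
  \<comment> \<open>The vector with first coordinates u and total r.\<close>
  let ?c = "\<lambda>u r. u(d := r - ?S u)"
  have ins: "{1..d} = insert d {1..<d}"
    using d by auto
  have split: "(\<integral>\<^sup>+y. f y \<partial>?P {1..d}) = (\<integral>\<^sup>+u. (\<integral>\<^sup>+t. f (u(d := t)) \<partial>lborel) \<partial>?P {1..<d})"
    if "f \<in> borel_measurable (?P {1..d})" for f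
    using that unfolding ins by (intro product_nn_integral_insert) simp_all
  note mH = measurable_cone_weight[OF d, of b]
  have [measurable]: "?S \<in> borel_measurable (\<Pi>\<^sub>M k\<in>{1..<d}. borel)"
    by (intro borel_measurable_sum measurable_component_singleton)
  have mF: "?F \<in> borel_measurable (?P {1..d})"
    unfolding measurable_PiM_lborel_eq
    by (intro borel_measurable_times_ennreal mH measurable_compose[OF _ measurable_radial]
        borel_measurable_sum measurable_component_singleton)
  have mHc: "(\<lambda>p. ?H (?c (fst p) (snd p))) \<in> borel_measurable (?P {1..<d} \<Otimes>\<^sub>M lborel)"
  proof (rule measurable_fun_upd_PiM_pair[OF ins _ mH])
    have "(\<lambda>p. ?S (fst p)) \<in> borel_measurable (?P {1..<d} \<Otimes>\<^sub>M (lborel :: real measure))"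
      by (rule measurable_compose[OF measurable_fst]) simp
    then show "(\<lambda>p. snd p - ?S (fst p)) \<in> borel_measurable (?P {1..<d} \<Otimes>\<^sub>M lborel)"
      by measurable
  qed
  have Sd: "(\<Sum>k=1..d. (u(d := t)) k) = ?S u + t" for u :: "nat \<Rightarrow> real" and t
    unfolding ins by simp
  have "(\<integral>\<^sup>+y. ?F y \<partial>?P {1..d}) = (\<integral>\<^sup>+u. (\<integral>\<^sup>+t. ?F (u(d := t)) \<partial>lborel) \<partial>?P {1..<d})"
    by (rule split[OF mF])
  also have "\<dots> = (\<integral>\<^sup>+u. (\<integral>\<^sup>+r. ?H (?c u r) * radial r \<partial>lborel) \<partial>?P {1..<d})"
  proof (rule nn_integral_cong)
    fix u assume u: "u \<in> space (?P {1..<d})"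
    have "(\<lambda>t. u(d := t)) \<in> measurable borel (\<Pi>\<^sub>M k\<in>{1..d}. borel)"
      by (rule measurable_fun_upd[where J = "{1..<d}"]) (use u ins in \<open>auto simp: space_PiM\<close>)
    from measurable_compose[OF this mF[unfolded measurable_PiM_lborel_eq]]
    have "(\<lambda>t. ?F (u(d := t))) \<in> borel_measurable borel" .
    from nn_integral_real_affine[OF this, of 1 "- ?S u"]
    show "(\<integral>\<^sup>+t. ?F (u(d := t)) \<partial>lborel) = (\<integral>\<^sup>+r. ?H (?c u r) * radial r \<partial>lborel)"
      unfolding Sd by (simp add: algebra_simps)
  qed
  also have "\<dots> = (\<integral>\<^sup>+r. (\<integral>\<^sup>+u. ?H (?c u r) * radial r \<partial>?P {1..<d}) \<partial>lborel)"
    by (rule nn_integral_PiM_Fubini[symmetric]) (use mHc in \<open>auto simp: split_beta'\<close>)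
  also have "\<dots> = (\<integral>\<^sup>+r. indicator {0<..1::real} r * GRD_const d b \<partial>lborel)"
  proof (rule nn_integral_cong)
    fix r :: real
    show "(\<integral>\<^sup>+u. ?H (?c u r) * radial r \<partial>?P {1..<d}) = indicator {0<..1} r * GRD_const d b"
    proof (cases "r \<in> {0<..1}")
      case True
      then have r: "0 < r" by simp
      have m: "(\<lambda>u. ?H (?c u s)) \<in> borel_measurable (?P {1..<d})" for s
      proof -
        have "(\<lambda>u. (u, s)) \<in> measurable (?P {1..<d}) (?P {1..<d} \<Otimes>\<^sub>M lborel)"
          by measurable
        from measurable_compose[OF this mHc] show ?thesis by simp
      qed
      have "(\<integral>\<^sup>+u. ?H (?c u r) * radial r \<partial>?P {1..<d}) = ennreal r * (\<integral>\<^sup>+u. ?H (?c u r) \<partial>?P {1..<d})"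
        using True by (subst nn_integral_multc[OF m]) (simp add: radial_def mult.commute)
      also have "\<dots> = ennreal r * (ennreal (r ^ (d - 1)) * (\<integral>\<^sup>+u. ?H (?c (\<lambda>k\<in>{1..<d}. r * u k) r) \<partial>?P {1..<d}))"
        by (subst nn_integral_PiM_lborel_scale[OF _ r m]) simp_all
      also have "(\<integral>\<^sup>+u. ?H (?c (\<lambda>k\<in>{1..<d}. r * u k) r) \<partial>?P {1..<d}) =
          (\<integral>\<^sup>+u. ?H (\<lambda>k. r * complete_coord d u k) \<partial>?P {1..<d})"
        by (intro nn_integral_cong cone_weight_cong[OF d])
          (auto simp: complete_coord_def sum_distrib_left algebra_simps)
      also have "ennreal r * (ennreal (r ^ (d - 1)) * \<dots>) =
          ennreal (r ^ d) * (\<integral>\<^sup>+u. ?H (\<lambda>k. r * complete_coord d u k) \<partial>?P {1..<d})"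
        using d r by (cases d) (simp_all add: ennreal_mult mult.assoc)
      also have "\<dots> = (\<integral>\<^sup>+u. ennreal (r ^ d) * ?H (\<lambda>k. r * complete_coord d u k) \<partial>?P {1..<d})"
      proof (rule nn_integral_cmult[symmetric])
        \<comment> \<open>The scaled vector is restricted to {1..d} only to make the map measurable
          into the product space; the weight reads no other coordinates.\<close>
        have "(\<lambda>u. \<lambda>k\<in>{1..d}. r * complete_coord d u k) \<in>
            measurable (\<Pi>\<^sub>M k\<in>{1..<d}. borel) (\<Pi>\<^sub>M k\<in>{1..d}. borel)"
          by (intro measurable_restrict borel_measurable_times borel_measurable_const
              measurable_compose[OF measurable_complete_coord[OF d]] measurable_component_singleton)
        from measurable_compose[OF this mH]
        have "(\<lambda>u. ?H (\<lambda>k\<in>{1..d}. r * complete_coord d u k)) \<in> borel_measurable (?P {1..<d})"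
          by (simp only: measurable_PiM_lborel_eq)
        moreover have "?H (\<lambda>k\<in>{1..d}. r * complete_coord d u k) = ?H (\<lambda>k. r * complete_coord d u k)" for u
          by (rule cone_weight_cong[OF d]) simp
        ultimately show "(\<lambda>u. ?H (\<lambda>k. r * complete_coord d u k)) \<in> borel_measurable (?P {1..<d})"
          by (simp only:)
      qed
      also have "\<dots> = GRD_const d b"
        by (simp only: cone_weight_scale[OF d b r] cone_weight_simplex_integral[OF d])
      finally show ?thesis
        by (simp only: indicator_simps(1)[OF True] mult_1_left)
    next
      case False
      then show ?thesis
        by (simp add: radial_def)
    qed
  qed
  also have "\<dots> = GRD_const d b"
    by (simp add: nn_integral_multc)
  finally show ?thesis .
qed

text \<open>Write y = t (1, z) with t the first coordinate. Homogeneity removes t from the weight,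
  and what remains of the radial factor integrates to 1 in t for every z in the section.\<close>

lemma cone_integral_first:
  assumes d: "1 \<le> d" and b: "tail d b 1 = 0"
  shows "(\<integral>\<^sup>+y. cone_weight d b y * radial (\<Sum>k=1..d. y k) \<partial>(\<Pi>\<^sub>M k\<in>{1..d}. lborel)) =
    (\<integral>\<^sup>+z. cone_weight d b (z(1 := 1)) \<partial>(\<Pi>\<^sub>M k\<in>{2..d}. lborel))"
proof -
  interpret product_sigma_finite "\<lambda>_::nat. lborel :: real measure"
    by (rule product_sigma_finite_lborel)
  let ?P = "\<lambda>I. \<Pi>\<^sub>M k\<in>I. (lborel :: real measure)"
  let ?H = "cone_weight d b"
  let ?S = "\<lambda>u :: nat \<Rightarrow> real. 1 + (\<Sum>k\<in>{2..d}. u k)"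
  let ?F = "\<lambda>y. ?H y * radial (\<Sum>k=1..d. y k)"
  \<comment> \<open>For t > 0 this is \<open>radial (t * ?S z)\<close> divided by t.\<close>
  let ?V = "\<lambda>z t. ennreal (?S z) * indicator {0<..} t * indicator {..1} (t * ?S z)"
  have ins: "{1..d} = insert 1 {2..d}"
    using d by auto
  have split: "(\<integral>\<^sup>+y. f y \<partial>?P {1..d}) = (\<integral>\<^sup>+t. (\<integral>\<^sup>+z. f (z(1 := t)) \<partial>?P {2..d}) \<partial>lborel)"
    if "f \<in> borel_measurable (?P {1..d})" for f
    using that unfolding ins by (intro product_nn_integral_insert_rev) simp_all
  note mH = measurable_cone_weight[OF d, of b]
  have mF: "?F \<in> borel_measurable (?P {1..d})"
    unfolding measurable_PiM_lborel_eq
    by (intro borel_measurable_times_ennreal mH measurable_compose[OF _ measurable_radial]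
        borel_measurable_sum measurable_component_singleton)
  have [measurable]: "?S \<in> borel_measurable (\<Pi>\<^sub>M k\<in>{2..d}. borel)"
    by (intro borel_measurable_add borel_measurable_const borel_measurable_sum measurable_component_singleton)
  have mH1: "(\<lambda>p. ?H ((fst p)(1 := 1))) \<in> borel_measurable (?P {2..d} \<Otimes>\<^sub>M (lborel :: real measure))"
    by (rule measurable_fun_upd_PiM_pair[OF ins _ mH]) measurable
  have pw: "ennreal (t ^ (d - 1)) * ?F ((\<lambda>k\<in>{2..d}. t * z k)(1 := t)) = ?H (z(1 := 1)) * ?V z t"
    if t: "0 < t" for z t
  proof -
    have 1: "?H ((\<lambda>k\<in>{2..d}. t * z k)(1 := t)) = ?H (\<lambda>k. t * (z(1 := 1)) k)"
      by (rule cone_weight_cong[OF d]) auto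
    have 2: "(\<Sum>k=1..d. ((\<lambda>k\<in>{2..d}. t * z k)(1 := t)) k) = t * ?S z"
      unfolding ins by (simp add: sum_distrib_left algebra_simps)
    \<comment> \<open>If \<open>?S z\<close> is not positive, both sides are 0, since
      \<open>ennreal\<close> sends such reals to 0.\<close>
    have 3: "radial (t * ?S z) = ennreal t * ?V z t"
      using t by (auto simp: radial_def indicator_def ennreal_mult' zero_less_mult_iff ennreal_neg not_less)
    have 4: "ennreal (t ^ (d - 1)) * ennreal t = ennreal (t ^ d)"
      using d t by (cases d) (simp_all add: ennreal_mult mult.commute)
    have "ennreal (t ^ (d - 1)) * ?F ((\<lambda>k\<in>{2..d}. t * z k)(1 := t)) =
        (ennreal (t ^ (d - 1)) * ennreal t) * ?H (\<lambda>k. t * (z(1 := 1)) k) * ?V z t"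
      unfolding 1 2 3 by (simp only: ac_simps)
    then show ?thesis
      unfolding 4 by (simp only: cone_weight_scale[OF d b t])
  qed
  \<comment> \<open>A negative first coordinate lies outside the cone; for t = 0 the first factor of
    the weight is 0 powr _ = 0.\<close>
  have neg: "?F (z(1 := t)) = 0" if "t \<le> 0" for z t
  proof (cases "chain 1 d (z(1 := t))")
    case True
    from chain_nonneg[OF this, of 1] that d have "t = 0" by simp
    then have "GRD_weight d b (z(1 := t)) = 0"
      using d unfolding GRD_weight_def by (intro prod_zero bexI[of _ 1]) simp_all
    then show ?thesis
      by (simp add: cone_weight_def)
  qed (simp add: cone_weight_def)
  have "(\<integral>\<^sup>+y. ?F y \<partial>?P {1..d}) = (\<integral>\<^sup>+t. (\<integral>\<^sup>+z. ?F (z(1 := t)) \<partial>?P {2..d}) \<partial>lborel)"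
    by (rule split[OF mF])
  also have "\<dots> = (\<integral>\<^sup>+t. (\<integral>\<^sup>+z. ?H (z(1 := 1)) * ?V z t \<partial>?P {2..d}) \<partial>lborel)"
  proof (rule nn_integral_cong)
    fix t :: real
    show "(\<integral>\<^sup>+z. ?F (z(1 := t)) \<partial>?P {2..d}) = (\<integral>\<^sup>+z. ?H (z(1 := 1)) * ?V z t \<partial>?P {2..d})"
    proof (cases "0 < t")
      case True
      have upd: "(\<lambda>z. z(1 := t)) \<in> measurable (?P {2..d}) (?P {1..d})"
        by (rule measurable_fun_upd[where J = "{2..d}"]) (use ins in auto)
      have m: "(\<lambda>z. ?F (z(1 := t))) \<in> borel_measurable (?P {2..d})"
        using measurable_compose[OF upd mF] .
      have sc: "(\<lambda>z. \<lambda>k\<in>{2..d}. t * z k) \<in> measurable (?P {2..d}) (?P {2..d})"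
        by measurable
      have "(\<integral>\<^sup>+z. ?F (z(1 := t)) \<partial>?P {2..d}) =
          ennreal (t ^ (d - 1)) * (\<integral>\<^sup>+z. ?F ((\<lambda>k\<in>{2..d}. t * z k)(1 := t)) \<partial>?P {2..d})"
        by (subst nn_integral_PiM_lborel_scale[OF _ True m]) simp_all
      also have "\<dots> = (\<integral>\<^sup>+z. ennreal (t ^ (d - 1)) * ?F ((\<lambda>k\<in>{2..d}. t * z k)(1 := t)) \<partial>?P {2..d})"
        by (rule nn_integral_cmult[symmetric]) (rule measurable_compose[OF sc m])
      finally show ?thesis
        by (simp only: pw[OF True])
    next
      case False
      then show ?thesis
        by (simp only: neg not_less) simp
    qed
  qed
  also have "\<dots> = (\<integral>\<^sup>+z. (\<integral>\<^sup>+t. ?H (z(1 := 1)) * ?V z t \<partial>lborel) \<partial>?P {2..d})"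
    by (rule nn_integral_PiM_Fubini) (use mH1 in \<open>auto simp: split_beta'\<close>)
  also have "\<dots> = (\<integral>\<^sup>+z. ?H (z(1 := 1)) \<partial>?P {2..d})"
  proof (rule nn_integral_cong)
    fix z :: "nat \<Rightarrow> real"
    show "(\<integral>\<^sup>+t. ?H (z(1 := 1)) * ?V z t \<partial>lborel) = ?H (z(1 := 1))"
    proof (cases "chain 1 d (z(1 := 1))")
      case True
      have "0 \<le> (\<Sum>k\<in>{2..d}. z k)"
      proof (rule sum_nonneg)
        fix k assume "k \<in> {2..d}"
        then show "0 \<le> z k"
          using chain_nonneg[OF True, of k] by simp
      qed
      then have S: "0 < ?S z" by simp
      \<comment> \<open>On the cone \<open>?S z\<close> is at least 1, so \<open>?V z\<close> is the
        constant \<open>?S z\<close> on an interval of length 1 / \<open>?S z\<close>.\<close>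
      have "?V z t = ennreal (?S z) * indicator {0<..1 / ?S z} t" for t
        using S by (auto simp: indicator_def field_simps)
      then have "(\<integral>\<^sup>+t. ?V z t \<partial>lborel) = 1"
        using S by (simp add: nn_integral_cmult flip: ennreal_mult)
      then show ?thesis
        by (subst nn_integral_cmult) simp_all
    qed (simp add: cone_weight_def)
  qed
  finally show ?thesis .
qed

section \<open>The normalising constant for parameters of total zero\<close>

text \<open>Both sections give the same integral, and the section with first coordinate 1 is
  evaluated by \<open>nn_integral_chain\<close> with s = 1, where every power of s is 1.\<close>

lemma GRD_const_tail_0:
  assumes "2 \<le> d" "\<And>k. k \<in> {2..d} \<Longrightarrow> 0 < tail d b k" "tail d b 1 = 0"
  shows "GRD_const d b = ennreal (\<Prod>k=2..d. 1 / tail d b k)"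
proof -
  have ins: "{1..d} = insert 1 {Suc 1..d}"
    using assms by auto
  have "GRD_const d b = (\<integral>\<^sup>+z. cone_weight d b (z(1 := 1)) \<partial>(\<Pi>\<^sub>M k\<in>{2..d}. lborel))"
    using cone_integral_last[of d b] cone_integral_first[of d b] assms by simp
  also have "\<dots> = (\<integral>\<^sup>+z. ennreal (\<Prod>k=Suc 1..d. z k powr (b k - 1)) *
      indicator (Collect (chain 1 d)) (z(1 := 1)) \<partial>(\<Pi>\<^sub>M k\<in>{2..d}. lborel))"
    unfolding cone_weight_def GRD_weight_def ins by simp
  finally show ?thesis
    using nn_integral_chain[of 1 d b 1] assms by (simp add: numeral_2_eq_2)
qed

section \<open>Normalising constants for parameters of total -L\<close>

lemma space_simplex_measure:
  "1 \<le> d \<Longrightarrow> space (simplex_measure d) = ord_simplex d"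
  by (auto simp: simplex_measure_def space_restrict_space space_PiM ord_simplex_eq)

lemma measurable_simplex_measure:
  "f \<in> measurable (\<Pi>\<^sub>M k\<in>{1..d}. borel) N \<Longrightarrow> f \<in> measurable (simplex_measure d) N"
  unfolding simplex_measure_def by (rule measurable_restrict_space1) (simp only: measurable_distr_eq1)

lemma measurable_GRD_weight_simplex [measurable]:
  "GRD_weight d a \<in> borel_measurable (simplex_measure d)"
  by (intro measurable_simplex_measure measurable_GRD_weight)

lemma GRD_weight_nonneg [simp]: "0 \<le> GRD_weight d a y"
  by (simp add: GRD_weight_def prod_nonneg)

text \<open>Multiplying by a monomial shifts the parameters. At a zero coordinate both sides vanish,
  even for exponent 0, because 0 powr _ = 0.\<close>

lemma GRD_weight_mult_power:
  assumes "\<And>k. k \<in> {1..d} \<Longrightarrow> 0 \<le> y k"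
  shows "GRD_weight d a y * (\<Prod>k=1..d. y k ^ n k) = GRD_weight d (\<lambda>k. a k + real (n k)) y"
  unfolding GRD_weight_def prod.distrib[symmetric]
proof (rule prod.cong[OF refl])
  fix k assume k: "k \<in> {1..d}"
  show "y k powr (a k - 1) * y k ^ n k = y k powr (a k + real (n k) - 1)"
  proof (cases "y k = 0")
    case False
    with assms[OF k] have "0 < y k" by simp
    then show ?thesis
      unfolding powr_realpow[OF \<open>0 < y k\<close>, symmetric] powr_add[symmetric]
      by (simp add: algebra_simps)
  qed simp
qed

text \<open>Insert the L-th power of the coordinate sum, which is 1 on the simplex, and expand; each
  monomial is absorbed as a shift of the parameters.\<close>

lemma GRD_const_multinomial:
  assumes "1 \<le> d"
  shows "GRD_const d a =
    (\<Sum>m\<in>weak_comps d L. ennreal (multinom d L m) * GRD_const d (\<lambda>k. a k + real (m k)))"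
proof -
  have W: "weak_comps d L = {m \<in> {1..d} \<rightarrow>\<^sub>E UNIV. sum m {1..d} = L}"
    by (simp add: weak_comps_def tail_def)
  have nn: "0 \<le> multinom d L m" for m
    by (simp add: multinom_def prod_nonneg)
  have "GRD_const d a = (\<integral>\<^sup>+y. (\<Sum>m\<in>weak_comps d L.
      ennreal (multinom d L m) * ennreal (GRD_weight d (\<lambda>k. a k + real (m k)) y)) \<partial>simplex_measure d)"
    unfolding GRD_const_def
  proof (rule nn_integral_cong)
    fix y assume "y \<in> space (simplex_measure d)"
    then have y: "chain 1 d y" "(\<Sum>k=1..d. y k) = 1"
      using assms by (auto simp: space_simplex_measure ord_simplex_eq)
    have "GRD_weight d a y = GRD_weight d a y * (\<Sum>k=1..d. y k) ^ L"
      by (simp only: y power_one mult_1_right)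
    also have "\<dots> = (\<Sum>m\<in>weak_comps d L. multinom d L m * (GRD_weight d a y * (\<Prod>k=1..d. y k ^ m k)))"
      unfolding sum_power_multinomial[OF finite_atLeastAtMost, symmetric] W
      by (simp add: sum_distrib_left multinom_def mult.left_commute)
    also have "\<dots> = (\<Sum>m\<in>weak_comps d L. multinom d L m * GRD_weight d (\<lambda>k. a k + real (m k)) y)"
      by (simp only: GRD_weight_mult_power[OF chain_nonneg[OF y(1)]])
    finally show "ennreal (GRD_weight d a y) = (\<Sum>m\<in>weak_comps d L.
        ennreal (multinom d L m) * ennreal (GRD_weight d (\<lambda>k. a k + real (m k)) y))"
      by (simp add: nn sum_ennreal flip: ennreal_mult)
  qed
  also have "\<dots> = (\<Sum>m\<in>weak_comps d L. ennreal (multinom d L m) * GRD_const d (\<lambda>k. a k + real (m k)))"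
    unfolding GRD_const_def
    by (subst nn_integral_sum) (simp_all add: nn_integral_cmult)
  finally show ?thesis .
qed

text \<open>A shift by m of total L brings the total of the parameters to 0 and keeps the later
  tails positive, so the closed product applies to each term. In particular the constant is
  finite.\<close>

lemma GRD_const_tail_neg:
  assumes d: "2 \<le> d" and a: "\<And>k. k \<in> {2..d} \<Longrightarrow> 0 < tail d a k"
    and "tail d a 1 = - real L"
  shows "GRD_const d a = ennreal (\<Sum>m\<in>weak_comps d L.
    multinom d L m * (\<Prod>k=2..d. 1 / (tail d a k + real (tail d m k))))"
proof -
  have nn: "0 \<le> multinom d L m" for m
    by (simp add: multinom_def prod_nonneg)
  have t: "tail d (\<lambda>k. a k + real (m k)) k = tail d a k + real (tail d m k)" for m k
    by (simp add: tail_def sum.distrib)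
  have c: "GRD_const d (\<lambda>k. a k + real (m k)) = ennreal (\<Prod>k=2..d. 1 / (tail d a k + real (tail d m k)))"
    if "m \<in> weak_comps d L" for m
  proof (subst GRD_const_tail_0[OF d], goal_cases)
    case (1 k)
    then show ?case unfolding t by (intro add_pos_nonneg a) auto
  next
    case 2
    then show ?case unfolding t using that assms by (simp add: weak_comps_def)
  qed (simp add: t)
  have p: "0 \<le> (\<Prod>k=2..d. 1 / (tail d a k + real (tail d m k)))" for m
    using a by (intro prod_nonneg) (auto simp: less_imp_le)
  show ?thesis
    using d by (subst GRD_const_multinomial[of d a L])
      (auto simp: c nn p sum_ennreal simp flip: ennreal_mult)
qed

section \<open>Moments as quotients of normalising constants\<close>

theorem theorem7:
  fixes d M :: nat and a :: "nat \<Rightarrow> real" and n :: "nat \<Rightarrow> nat"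
  assumes "2 \<le> d"
    and "\<And>k. k \<in> {2..d} \<Longrightarrow> 0 < tail d a k"
    and "1 \<le> M"
    and "tail d a 1 = - real M"
    and "tail d n 1 \<le> M"
  shows "prob_space.expectation (GRD d a) (\<lambda>Y. \<Prod>k=1..d. Y k ^ n k) =
    (\<Sum>m\<in>weak_comps d (M - tail d n 1). multinom d (M - tail d n 1) m *
       (\<Prod>k=2..d. tail d a k / (tail d a k + real (tail d m k) + real (tail d n k)))) /
    (\<Sum>m\<in>weak_comps d M. multinom d M m *
       (\<Prod>k=2..d. tail d a k / (tail d a k + real (tail d m k))))"
proof -
  note d = assms(1) and a = assms(2)
  \<comment> \<open>Expanding the quotient by A turns each numerator 1 into the tail required by the
    statement.\<close>
  define A where "A = (\<Prod>k=2..d. tail d a k)"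
  define R where "R = (\<Sum>m\<in>weak_comps d M.
    multinom d M m * (\<Prod>k=2..d. 1 / (tail d a k + real (tail d m k))))"
  define R' where "R' = (\<Sum>m\<in>weak_comps d (M - tail d n 1).
    multinom d (M - tail d n 1) m * (\<Prod>k=2..d. 1 / (tail d a k + real (tail d m k) + real (tail d n k))))"
  have A: "A \<noteq> 0"
    unfolding A_def using a by (intro less_imp_neq[symmetric] prod_pos) simp
  have mn: "0 < multinom d L m" for L m
    by (simp add: multinom_def prod_pos)
  have Q: "GRD_const d a = ennreal R"
    unfolding R_def by (rule GRD_const_tail_neg[OF d a assms(4)])
  have t: "tail d (\<lambda>k. a k + real (n k)) k = tail d a k + real (tail d n k)" for k
    by (simp add: tail_def sum.distrib)
  \<comment> \<open>The total of a + n is -(M - \<open>tail d n 1\<close>); the subtraction in nat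
    is exact because \<open>tail d n 1\<close> is at most M.\<close>
  have Q': "GRD_const d (\<lambda>k. a k + real (n k)) = ennreal R'"
    unfolding R'_def
    by (subst GRD_const_tail_neg[OF d, of _ "M - tail d n 1"])
      (use a assms(4,5) in \<open>auto simp: t of_nat_diff add_pos_nonneg add_ac\<close>)
  have R0: "0 < R"
  proof -
    have W: "weak_comps d M = {m \<in> {1..d} \<rightarrow>\<^sub>E UNIV. sum m {1..d} = M}"
      by (simp add: weak_comps_def tail_def)
    have "weak_comps d M \<subseteq> {1..d} \<rightarrow>\<^sub>E {..M}"
      unfolding W by (auto simp: PiE_def Pi_def member_le_sum)
    then have fin: "finite (weak_comps d M)"
      by (rule finite_subset) (simp add: finite_PiE)
    \<comment> \<open>Putting all of M into the first coordinate shows that the sum of positive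
      terms is not empty.\<close>
    have "(\<lambda>k\<in>{1..d}. if k = 1 then M else 0) \<in> weak_comps d M"
      unfolding W using d by simp
    then show ?thesis
      unfolding R_def using a mn fin
      by (intro sum_pos mult_pos_pos prod_pos) (auto intro: add_pos_nonneg)
  qed
  have R'0: "0 \<le> R'"
    unfolding R'_def using a less_imp_le[OF mn]
    by (intro sum_nonneg mult_nonneg_nonneg prod_nonneg) (auto simp: less_imp_le)
  let ?p = "\<lambda>Y :: nat \<Rightarrow> real. \<Prod>k=1..d. Y k ^ n k"
  have mp: "?p \<in> borel_measurable (simplex_measure d)"
    by (intro measurable_simplex_measure borel_measurable_prod borel_measurable_power
        measurable_component_singleton)
  \<comment> \<open>Since R is positive, division in \<open>ennreal\<close> becomes real division,
    and the expectation can be treated as a Bochner integral with a real density.\<close>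
  have dens: "ennreal (GRD_weight d a y) / GRD_const d a = ennreal (GRD_weight d a y / R)" for y
    unfolding Q using R0 by (simp add: divide_ennreal)
  have "prob_space.expectation (GRD d a) ?p = (\<integral>y. GRD_weight d a y / R * ?p y \<partial>simplex_measure d)"
    unfolding GRD_def dens using R0 mp by (subst integral_density) simp_all
  also have "\<dots> = (\<integral>y. GRD_weight d (\<lambda>k. a k + real (n k)) y / R \<partial>simplex_measure d)"
  proof (rule Bochner_Integration.integral_cong[OF refl])
    fix y assume "y \<in> space (simplex_measure d)"
    then have "chain 1 d y"
      using d by (simp add: space_simplex_measure ord_simplex_eq)
    note w = GRD_weight_mult_power[OF chain_nonneg[OF this]]
    show "GRD_weight d a y / R * ?p y = GRD_weight d (\<lambda>k. a k + real (n k)) y / R"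
      by (simp only: times_divide_eq_left w)
  qed
  also have "\<dots> = enn2real (GRD_const d (\<lambda>k. a k + real (n k))) / R"
    unfolding GRD_const_def
    by (subst integral_divide_zero, subst integral_eq_nn_integral) simp_all
  also have "\<dots> = R' / R"
    unfolding Q' using R'0 by simp
  also have "\<dots> = (A * R') / (A * R)"
    using A by simp
  also have "A * R' = (\<Sum>m\<in>weak_comps d (M - tail d n 1). multinom d (M - tail d n 1) m *
       (\<Prod>k=2..d. tail d a k / (tail d a k + real (tail d m k) + real (tail d n k))))"
    by (simp add: A_def R'_def sum_distrib_left prod_dividef ac_simps)
  also have "A * R = (\<Sum>m\<in>weak_comps d M. multinom d M m *
       (\<Prod>k=2..d. tail d a k / (tail d a k + real (tail d m k))))"
    by (simp add: A_def R_def sum_distrib_left prod_dividef ac_simps)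
  finally show ?thesis .
qed

end
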